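(* Let $S, T, U$ be pairwise disjoint finite index sets, $N = S\cup T\cup U$, and consider a rational polyhedron of the form \[ P = \{ (x,y,z) \in \mathbb{R}^S \times \mathbb{R}^T \times \mathbb{R}^U \mid Ax + By \leq c, ~ y\geq 0, ~ Dx + Ez \leq f \}. \] If, for some $k \geq 1$, $B$ is $k$-regular and $c - A \bar{x} \equiv 0 \pmod k$ (i.e., every entry of $c - A\bar x$ is an integer multiple of $k$) for all $\bar{x} \in \mathrm{proj}_S(P) \cap \mathbb{Z}^S$, then $y$ is totally implied integer by $x$ for $P$.
   Context: A matrix $B$ is $k$-regular if for each non-singular square submatrix $R$ of $B$, $k R^{-1}$ is integral. $\mathrm{proj}_S(P)$ denotes the projection of $P$ onto the $x$-coordinates. For $S' \subseteq N$, $\mathcal{M}^{S'} \coloneqq \{ w \in \mathbb{R}^N \mid w_i \in \mathbb{Z} \ \forall i \in S' \}$. For $S',T'\subseteq N$, $x_{T'}$ is implied integer by $x_{S'}$ for $P$ if $\mathrm{conv}(P \cap \mathcal{M}^{S'}) = \mathrm{conv}(P \cap \mathcal{M}^{S' \cup T'})$; it is totally implied integer by $x_{S'}$ if it is implied integer by $x_{S''}$ for every $S''$ with $S' \subseteq S'' \subseteq N$. "$y$ totally implied integer by $x$" means $x_T$ is totally implied integer by $x_S$. *)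

theory Defs
  imports "HOL-Analysis.Analysis"
begin

text \<open>
  For an index set \<open>N\<close> contained in a finite type \<open>'n\<close>, the space \<open>\<real>\<^sup>N\<close> is rendered as the coordinate
  subspace of \<^typ>\<open>real ^ 'n\<close> of vectors vanishing outside \<open>N\<close>; so index sets may be empty.
  Matrices are functions of a row and a column index, with explicit finite row and column sets.
\<close>

definition coord_space :: "'n set \<Rightarrow> (real ^ 'n) set" where
  "coord_space N = {w. \<forall>i. i \<notin> N \<longrightarrow> w $ i = 0}"

definition mixed_int :: "'n set \<Rightarrow> 'n set \<Rightarrow> (real ^ 'n) set" where
  "mixed_int N S' = {w \<in> coord_space N. \<forall>i \<in> S'. w $ i \<in> \<int>}"

definition coord_proj :: "'n set \<Rightarrow> (real ^ 'n) set \<Rightarrow> (real ^ 'n) set" where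
  "coord_proj S P = (\<lambda>w. \<chi> i. if i \<in> S then w $ i else 0) ` P"

definition rational_polyhedron :: "(real ^ 'n) set \<Rightarrow> bool" where
  "rational_polyhedron P \<longleftrightarrow>
    (\<exists>F :: ((real ^ 'n) \<times> real) set. finite F \<and>
      (\<forall>(a, b) \<in> F. (\<forall>i. a $ i \<in> \<rat>) \<and> b \<in> \<rat>) \<and>
      P = {w. \<forall>(a, b) \<in> F. a \<bullet> w \<le> b})"

text \<open>\<open>X\<close>, with rows \<open>J\<close> and columns \<open>I\<close>, is the inverse of \<open>R\<close>, with rows \<open>I\<close> and columns \<open>J\<close>.\<close>

definition inverse_on :: "'m set \<Rightarrow> 'n set \<Rightarrow> ('m \<Rightarrow> 'n \<Rightarrow> real) \<Rightarrow> ('n \<Rightarrow> 'm \<Rightarrow> real) \<Rightarrow> bool" where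
  "inverse_on I J R X \<longleftrightarrow>
    (\<forall>i \<in> I. \<forall>i' \<in> I. (\<Sum>j \<in> J. R i j * X j i') = (if i = i' then 1 else 0)) \<and>
    (\<forall>j \<in> J. \<forall>j' \<in> J. (\<Sum>i \<in> I. X j i * R i j') = (if j = j' then 1 else 0))"

text \<open>The square submatrix of \<open>B\<close> on rows \<open>I'\<close> and columns \<open>J'\<close> is non-singular iff some \<open>X\<close> is its
  inverse; the entries of \<open>X\<close> at \<open>J' \<times> I'\<close> are then unique.\<close>

definition k_regular :: "nat \<Rightarrow> 'm set \<Rightarrow> 'n set \<Rightarrow> ('m \<Rightarrow> 'n \<Rightarrow> real) \<Rightarrow> bool" where
  "k_regular k I J B \<longleftrightarrow>
    (\<forall>I' J' X. I' \<subseteq> I \<and> J' \<subseteq> J \<and> card I' = card J' \<and> inverse_on I' J' B X \<longrightarrow>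
      (\<forall>j \<in> J'. \<forall>i \<in> I'. real k * X j i \<in> \<int>))"

definition implied_integer :: "'n set \<Rightarrow> (real ^ 'n) set \<Rightarrow> 'n set \<Rightarrow> 'n set \<Rightarrow> bool" where
  "implied_integer N P S' T' \<longleftrightarrow>
    convex hull (P \<inter> mixed_int N S') = convex hull (P \<inter> mixed_int N (S' \<union> T'))"

text \<open>The variables indexed by \<open>T'\<close> are totally implied integer by those indexed by \<open>S'\<close>.\<close>

definition totally_implied_integer :: "'n set \<Rightarrow> (real ^ 'n) set \<Rightarrow> 'n set \<Rightarrow> 'n set \<Rightarrow> bool" where
  "totally_implied_integer N P S' T' \<longleftrightarrow>
    (\<forall>S''. S' \<subseteq> S'' \<and> S'' \<subseteq> N \<longrightarrow> implied_integer N P S'' T')"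

end

theory Submission imports Defs begin

text \<open>
  Fix a point \<open>w\<close> of \<open>P\<close> whose \<open>S\<close>-part is integral and freeze all its coordinates outside \<open>T\<close>.
  The remaining fibre \<open>{y. 0 \<le> y, By \<le> c - Ax}\<close> may be unbounded, so it is cut with a box \<open>[0, M]\<^sup>T\<close>
  containing \<open>w\<close>; the entries of \<open>B\<close> are rational by regularity, so \<open>M\<close> can be
  chosen such that \<open>M B\<close> is divisible by \<open>k\<close>. The cut fibre is compact, hence the convex hull of its
  extreme points. At an extreme point the coordinates strictly between \<open>0\<close> and \<open>M\<close> solve a
  non-singular subsystem \<open>R y = r\<close> of tight rows with \<open>r\<close> divisible by \<open>k\<close>, so
  \<open>y = (k R\<^sup>-\<^sup>1) (r / k)\<close> is integral. Integrality of the coordinates outside \<open>T\<close> is untouched.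
\<close>

section \<open>Coordinate subspaces and invertible square submatrices\<close>

lemma subspace_coord_space: "subspace (coord_space J)"
  by (auto simp: subspace_def coord_space_def)

lemma coord_space_expand:
  assumes "v \<in> coord_space (J :: 'n::finite set)"
  shows "v = (\<Sum>j\<in>J. v $ j *\<^sub>R axis j 1)"
  using assms by (auto simp: vec_eq_iff coord_space_def axis_def if_distrib sum.delta cong: if_cong)

lemma inner_restrict_coords:
  fixes u :: "real ^ 'n::finite"
  shows "(\<chi> j. if j \<in> J then g j else 0) \<bullet> u = (\<Sum>j\<in>J. g j * u $ j)"
  by (simp add: inner_vec_def if_distribR if_distrib sum.If_cases cong: if_cong)

text \<open>The traces of \<open>R X\<close> and \<open>X R\<close> agree; the first is
  \<open>card I\<close>, the second \<open>card J\<close>. This supplies the squareness that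
  \<open>k_regular\<close> asks for explicitly.\<close>

lemma inverse_on_card_eq:
  assumes "finite I" "finite J" "inverse_on I J R X"
  shows "card I = card J"
proof -
  have "real (card I) = (\<Sum>i\<in>I. \<Sum>j\<in>J. R i j * X j i)"
    using assms(3) by (simp add: inverse_on_def)
  also have "\<dots> = (\<Sum>j\<in>J. \<Sum>i\<in>I. X j i * R i j)"
    by (subst sum.swap) (simp add: mult.commute)
  also have "\<dots> = real (card J)"
    using assms(3) by (simp add: inverse_on_def)
  finally show ?thesis by simp
qed

text \<open>A trivial kernel means that the rows, restricted to \<open>J\<close>, span
  \<open>coord_space J\<close>. A basis chosen among them gives \<open>I'\<close>, and the
  coefficients of the unit vectors in this basis form the inverse \<open>X\<close>.\<close>

lemma full_column_rank_imp_invertible_rows: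
  fixes R :: "'m \<Rightarrow> 'n::finite \<Rightarrow> real"
  assumes fin: "finite I"
    and inj: "\<And>u. u \<in> coord_space J \<Longrightarrow> (\<And>i. i \<in> I \<Longrightarrow> (\<Sum>j\<in>J. R i j * u $ j) = 0) \<Longrightarrow> u = 0"
  obtains I' X where "I' \<subseteq> I" "inverse_on I' J R X"
proof -
  define r where "r i = (\<chi> j. if j \<in> J then R i j else 0)" for i
  have r_inner: "r i \<bullet> u = (\<Sum>j\<in>J. R i j * u $ j)" for i u
    by (simp add: r_def inner_restrict_coords)
  have r_in: "r i \<in> coord_space J" for i
    by (simp add: r_def coord_space_def)
  have span_sub: "span (r ` I) \<subseteq> coord_space J"
    by (rule span_minimal) (use r_in subspace_coord_space in auto)
  have span_eq: "span (r ` I) = coord_space J"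
  \<comment> \<open>If the span were proper, some nonzero vector of \<open>coord_space J\<close>
    would be orthogonal to every row, hence lie in the kernel.\<close>
  proof (rule ccontr)
    assume "span (r ` I) \<noteq> coord_space J"
    then have "span (r ` I) \<subset> span (coord_space J)"
      using span_sub subspace_coord_space by (metis psubsetI span_eq_iff)
    then obtain u where u: "u \<noteq> 0" "u \<in> span (coord_space J)"
      "\<And>y. y \<in> span (r ` I) \<Longrightarrow> orthogonal u y"
      by (rule orthogonal_to_subspace_exists_gen) blast
    have "u \<in> coord_space J"
      using u(2) subspace_coord_space by (metis span_eq_iff)
    moreover have "(\<Sum>j\<in>J. R i j * u $ j) = 0" if "i \<in> I" for i
      using u(3)[of "r i"] that r_inner[of i u]
      by (auto simp: orthogonal_def inner_commute span_base)
    ultimately show False using inj u(1) by blast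
  qed
  obtain V where V: "V \<subseteq> r ` I" "independent V" "r ` I \<subseteq> span V"
    using maximal_independent_subset by blast
  \<comment> \<open>Different indices may carry equal rows, so the basis is pulled back to indices
    on which \<open>r\<close> is injective.\<close>
  obtain I' where I': "I' \<subseteq> I" "inj_on r I'" "V = r ` I'"
    using V(1) by (auto simp: subset_image_inj)
  have finI': "finite I'" using I'(1) fin finite_subset by blast
  have spanV: "span V = coord_space J"
    using V span_eq span_mono span_minimal subspace_span by (metis subset_antisym)
  have "\<exists>u. axis j 1 = (\<Sum>i\<in>I'. u i *\<^sub>R r i)" if "j \<in> J" for j
  proof -
    have "(axis j 1 :: real^'n) \<in> span V"
      unfolding spanV using that by (auto simp: coord_space_def axis_def)
    then obtain u where "(axis j 1 :: real^'n) = (\<Sum>v\<in>V. u v *\<^sub>R v)"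
      using finI' I'(3) by (auto simp: span_finite)
    then have "(axis j 1 :: real^'n) = (\<Sum>i\<in>I'. u (r i) *\<^sub>R r i)"
      using I' by (simp add: sum.reindex)
    then show ?thesis by (rule exI[of _ "\<lambda>i. u (r i)"])
  qed
  then obtain X where X: "\<And>j. j \<in> J \<Longrightarrow> axis j 1 = (\<Sum>i\<in>I'. X j i *\<^sub>R r i)"
    by metis
  have unique: "d i = 0" if "(\<Sum>i\<in>I'. d i *\<^sub>R r i) = 0" "i \<in> I'" for d i
  proof -
    have "(\<Sum>v\<in>V. d (inv_into I' r v) *\<^sub>R v) = 0"
      using that I' by (simp add: sum.reindex)
    moreover have "finite V" "r i \<in> V" using finI' I'(3) that(2) by auto
    ultimately have "d (inv_into I' r (r i)) = 0"
      using independentD[OF V(2) _ subset_refl, of "\<lambda>v. d (inv_into I' r v)" "r i"] by blast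
    then show ?thesis using that I' by simp
  qed
  have left: "(\<Sum>i\<in>I'. X j i * R i j') = (if j = j' then 1 else 0)" if "j \<in> J" "j' \<in> J" for j j'
  proof -
    have "(axis j 1 :: real^'n) $ j' = (\<Sum>i\<in>I'. X j i *\<^sub>R r i) $ j'"
      using X that by simp
    then show ?thesis using that by (auto simp: axis_def r_def split: if_splits)
  qed
  \<comment> \<open>The row \<open>r i\<close> is expanded in the basis twice: through the unit
    vectors, with the entries of \<open>R X\<close> as coefficients, and trivially as itself.
    Independence equates the coefficients.\<close>
  have right: "(\<Sum>j\<in>J. R i j * X j i') = (if i = i' then 1 else 0)" if "i \<in> I'" "i' \<in> I'" for i i'
  proof -
    have "r i = (\<Sum>j\<in>J. R i j *\<^sub>R axis j 1)"
      by (subst coord_space_expand[OF r_in]) (simp add: r_def)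
    also have "\<dots> = (\<Sum>j\<in>J. \<Sum>l\<in>I'. (R i j * X j l) *\<^sub>R r l)"
      by (simp add: X scaleR_sum_right)
    also have "\<dots> = (\<Sum>l\<in>I'. (\<Sum>j\<in>J. R i j * X j l) *\<^sub>R r l)"
      by (subst sum.swap) (simp add: scaleR_sum_left)
    finally have "r i = (\<Sum>l\<in>I'. (\<Sum>j\<in>J. R i j * X j l) *\<^sub>R r l)" .
    moreover have "r i = (\<Sum>l\<in>I'. (if i = l then 1 else 0) *\<^sub>R r l)"
      using that finI' by (simp add: if_distrib if_distribR sum.delta cong: if_cong)
    ultimately have "(\<Sum>l\<in>I'. ((\<Sum>j\<in>J. R i j * X j l) - (if i = l then 1 else 0)) *\<^sub>R r l) = 0"
      by (simp add: scaleR_diff_left sum_subtractf)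
    from unique[OF this that(2)] show ?thesis by simp
  qed
  have "inverse_on I' J R X"
    using left right by (simp add: inverse_on_def)
  then show thesis using that I'(1) by blast
qed

section \<open>Rational entries and common denominators\<close>

lemma k_regular_entry_Rats:
  assumes "k_regular k I J B" "k \<ge> 1" "i \<in> I" "j \<in> J"
  shows "B i j \<in> \<rat>"
proof (cases "B i j = 0")
  case False
  \<comment> \<open>A nonzero entry is a non-singular submatrix of order one, so
    \<open>k / B i j\<close> is an integer, and dividing \<open>k\<close> by it recovers the
    entry.\<close>
  have "inverse_on {i} {j} B (\<lambda>_ _. 1 / B i j)"
    using False by (simp add: inverse_on_def)
  then have "real k * (1 / B i j) \<in> \<int>"
    using assms unfolding k_regular_def
    by (metis card.empty card.insert empty_subsetI finite.emptyI insert_absorb insert_not_empty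
        insert_subset singletonI)
  then have "real k / (real k * (1 / B i j)) \<in> \<rat>"
    by (intro Rats_divide) (use Ints_subset_Rats in auto)
  then show ?thesis using assms(2) by simp
qed simp

lemma finite_Rats_common_denominator:
  assumes "finite Q" "Q \<subseteq> (\<rat> :: real set)"
  obtains d :: nat where "d \<ge> 1" "\<And>q. q \<in> Q \<Longrightarrow> real d * q \<in> \<int>"
proof -
  have "\<exists>d::nat. d \<ge> 1 \<and> (\<forall>q\<in>Q. real d * q \<in> \<int>)"
    using assms
  proof (induction Q)
    case empty
    show ?case by (auto intro: exI[of _ 1])
  next
    case (insert q Q)
    then obtain d :: nat where d: "d \<ge> 1" "\<forall>q\<in>Q. real d * q \<in> \<int>" by auto
    obtain a and b :: int where ab: "b > 0" "q = of_int a / of_int b"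
      using insert.prems by (metis Rats_cases' insert_subset)
    have eq: "real (d * nat b) = real d * of_int b" using ab by simp
    have "real (d * nat b) * q = of_int (int d * a)"
      using ab unfolding eq by simp
    then have 1: "real (d * nat b) * q \<in> \<int>" by (metis Ints_of_int)
    have 2: "real (d * nat b) * q' \<in> \<int>" if "q' \<in> Q" for q'
    proof -
      have "real (d * nat b) * q' = of_int b * (real d * q')" unfolding eq by simp
      also have "\<dots> \<in> \<int>" using d(2) that by (blast intro: Ints_mult Ints_of_int)
      finally show ?thesis .
    qed
    have "d * nat b \<ge> 1" using d ab by (simp add: Suc_le_eq)
    with 1 2 show ?case by blast
  qed
  then show thesis using that by blast
qed

section \<open>Convexity and compactness of the boxed fibre\<close>

definition boxed_fibre ::
  "'m set \<Rightarrow> 'n::finite set \<Rightarrow> ('m \<Rightarrow> 'n \<Rightarrow> real) \<Rightarrow> ('m \<Rightarrow> real) \<Rightarrow> real \<Rightarrow> real ^ 'n \<Rightarrow> (real ^ 'n) set"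
where
  "boxed_fibre I T B b M w =
    {v. (\<forall>j. j \<notin> T \<longrightarrow> v $ j = w $ j) \<and> (\<forall>j\<in>T. 0 \<le> v $ j \<and> v $ j \<le> M) \<and>
        (\<forall>i\<in>I. (\<Sum>j\<in>T. B i j * v $ j) \<le> b i)}"

lemma convex_boxed_fibre: "convex (boxed_fibre I T B b M w)"
proof -
  have eq: "boxed_fibre I T B b M w =
      (\<Inter>j\<in>-T. {v. axis j 1 \<bullet> v = w $ j}) \<inter>
      (\<Inter>j\<in>T. {v. axis j 1 \<bullet> v \<ge> 0} \<inter> {v. axis j 1 \<bullet> v \<le> M}) \<inter>
      (\<Inter>i\<in>I. {v. (\<chi> j. if j \<in> T then B i j else 0) \<bullet> v \<le> b i})"
    by (auto simp: boxed_fibre_def inner_axis' inner_restrict_coords)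
  show ?thesis
    unfolding eq
    by (intro convex_Int convex_INT convex_hyperplane convex_halfspace_le convex_halfspace_ge)
qed

lemma compact_boxed_fibre: "compact (boxed_fibre I T B b M w)"
proof -
  have "boxed_fibre I T B b M w =
      (\<Inter>j\<in>-T. {v. v $ j = w $ j}) \<inter> (\<Inter>j\<in>T. {v. 0 \<le> v $ j} \<inter> {v. v $ j \<le> M}) \<inter>
      (\<Inter>i\<in>I. {v. (\<Sum>j\<in>T. B i j * v $ j) \<le> b i})"
    by (auto simp: boxed_fibre_def)
  also have "closed \<dots>"
    by (intro closed_Int closed_INT ballI closed_Collect_le closed_Collect_eq continuous_intros)
  finally have "closed (boxed_fibre I T B b M w)" .
  moreover have "boxed_fibre I T B b M w \<subseteq>
      cbox (\<chi> j. if j \<in> T then 0 else w $ j) (\<chi> j. if j \<in> T then M else w $ j)"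
    by (auto simp: boxed_fibre_def mem_box_cart)
  ultimately show ?thesis
    by (meson bounded_cbox bounded_subset compact_eq_bounded_closed)
qed

section \<open>Extreme points of the boxed fibre\<close>

lemma eventually_perturb_le:
  fixes a s t :: real
  assumes "a < t \<or> a \<le> t \<and> s = 0"
  shows "\<forall>\<^sub>F e in at_right 0. a + e * s \<le> t"
proof (cases "s = 0")
  case False
  have "((\<lambda>e. a + e * s) \<longlongrightarrow> a + 0 * s) (at_right 0)"
    by (intro tendsto_intros)
  then have "\<forall>\<^sub>F e in at_right 0. a + e * s < t"
    using False assms by (intro order_tendstoD(2)[of _ a]) auto
  then show ?thesis by (rule eventually_mono) simp
qed (use assms in auto)

text \<open>There are finitely many constraints. A slack one survives a small step by continuity. A
  tight one does not change along \<open>u\<close>: tight rows by assumption, tight bounds because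
  \<open>u\<close> vanishes at coordinates that sit at 0 or \<open>M\<close>.\<close>

lemma eventually_perturb_in_boxed_fibre:
  assumes fin: "finite I" and y: "y \<in> boxed_fibre I T B b M w"
    and u: "u \<in> coord_space {j \<in> T. 0 < y $ j \<and> y $ j < M}"
    and tight: "\<And>i. i \<in> I \<Longrightarrow> (\<Sum>j\<in>T. B i j * y $ j) = b i \<Longrightarrow> (\<Sum>j\<in>T. B i j * u $ j) = 0"
  shows "\<forall>\<^sub>F e in at_right 0. y + e *\<^sub>R u \<in> boxed_fibre I T B b M w"
proof -
  have u0: "u $ j = 0" if "\<not> (j \<in> T \<and> 0 < y $ j \<and> y $ j < M)" for j
    using u that by (auto simp: coord_space_def)
  have "\<forall>\<^sub>F e in at_right 0. \<forall>j\<in>T. - (y $ j) + e * - (u $ j) \<le> 0"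
    using y u0 by (intro eventually_ball_finite ballI eventually_perturb_le)
      (force simp: boxed_fibre_def)+
  moreover have "\<forall>\<^sub>F e in at_right 0. \<forall>j\<in>T. y $ j + e * u $ j \<le> M"
    using y u0 by (intro eventually_ball_finite ballI eventually_perturb_le)
      (force simp: boxed_fibre_def)+
  moreover have "\<forall>\<^sub>F e in at_right 0.
      \<forall>i\<in>I. (\<Sum>j\<in>T. B i j * y $ j) + e * (\<Sum>j\<in>T. B i j * u $ j) \<le> b i"
    using y tight by (intro eventually_ball_finite ballI eventually_perturb_le fin)
      (force simp: boxed_fibre_def)
  ultimately show ?thesis
  proof eventually_elim
    case (elim e)
    have "(\<Sum>j\<in>T. B i j * (y $ j + e * u $ j)) =
        (\<Sum>j\<in>T. B i j * y $ j) + e * (\<Sum>j\<in>T. B i j * u $ j)" for i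
      by (simp add: sum_distrib_left sum.distrib algebra_simps)
    with elim y u0 show ?case by (auto simp: boxed_fibre_def)
  qed
qed

text \<open>The divisibility of \<open>B i j * M\<close> makes coordinates resting at the upper
  bound harmless: moved to the right-hand side of a tight row, they change it by a multiple of
  \<open>k\<close>.\<close>

lemma extreme_point_boxed_fibre_integral:
  assumes fin: "finite I" and reg: "k_regular k I T B"
    and ext: "y extreme_point_of boxed_fibre I T B b M w"
    and M: "M \<in> \<int>" "\<And>i j. i \<in> I \<Longrightarrow> j \<in> T \<Longrightarrow> \<exists>q::int. B i j * M = of_int q * real k"
    and b: "\<And>i. i \<in> I \<Longrightarrow> \<exists>q::int. b i = of_int q * real k"
    and j: "j \<in> T"
  shows "y $ j \<in> \<int>"
proof -
  let ?F = "boxed_fibre I T B b M w"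
  define J where "J = {j \<in> T. 0 < y $ j \<and> y $ j < M}"
  define I0 where "I0 = {i \<in> I. (\<Sum>j\<in>T. B i j * y $ j) = b i}"
  have J: "J \<subseteq> T" by (auto simp: J_def)
  have y: "y \<in> ?F" using ext by (simp add: extreme_point_of_def)
  \<comment> \<open>A nonzero \<open>u\<close> in the kernel of the tight rows could be followed in
    both directions, making \<open>y\<close> the midpoint of a segment inside the fibre.\<close>
  have inj: "u = 0"
    if u: "u \<in> coord_space J" and u0: "\<And>i. i \<in> I0 \<Longrightarrow> (\<Sum>j\<in>J. B i j * u $ j) = 0" for u
  proof (rule ccontr)
    assume "u \<noteq> 0"
    have sums: "(\<Sum>j\<in>T. B i j * u $ j) = 0"
      if "i \<in> I" "(\<Sum>j\<in>T. B i j * y $ j) = b i" for i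
    proof -
      have "(\<Sum>j\<in>T. B i j * u $ j) = (\<Sum>j\<in>J. B i j * u $ j)"
        using J u by (intro sum.mono_neutral_right) (auto simp: coord_space_def)
      then show ?thesis using u0 that by (simp add: I0_def)
    qed
    have "\<forall>\<^sub>F e in at_right 0. y + e *\<^sub>R u \<in> ?F"
      using eventually_perturb_in_boxed_fibre[OF fin y] u sums by (simp add: J_def)
    moreover have "\<forall>\<^sub>F e in at_right 0. y + e *\<^sub>R (- u) \<in> ?F"
      using u sums by (intro eventually_perturb_in_boxed_fibre[OF fin y])
        (auto simp: J_def coord_space_def sum_negf)
    moreover have "\<forall>\<^sub>F e in at_right (0::real). e > 0"
      by (simp add: eventually_at_right_less)
    ultimately have "\<forall>\<^sub>F e in at_right 0. y + e *\<^sub>R u \<in> ?F \<and> y + e *\<^sub>R (- u) \<in> ?F \<and> e > 0"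
      by eventually_elim simp
    then obtain e where e: "y + e *\<^sub>R u \<in> ?F" "y + e *\<^sub>R (- u) \<in> ?F" "e > 0"
      using eventually_happens'[OF trivial_limit_at_right_real] by blast
    have "y = midpoint (y + e *\<^sub>R u) (y + e *\<^sub>R (- u))"
      by (simp add: midpoint_def scaleR_2[symmetric])
    moreover have "y + e *\<^sub>R u \<noteq> y + e *\<^sub>R (- u)"
      using e(3) \<open>u \<noteq> 0\<close> by (simp add: eq_neg_iff_add_eq_0 scaleR_2[symmetric])
    ultimately have "y \<in> open_segment (y + e *\<^sub>R u) (y + e *\<^sub>R (- u))"
      by (metis midpoint_in_open_segment)
    then show False using ext e by (auto simp: extreme_point_of_def)
  qed
  have "finite I0" using fin by (simp add: I0_def)
  then obtain I' X where I': "I' \<subseteq> I0" "inverse_on I' J B X"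
    using full_column_rank_imp_invertible_rows[of I0 J B] inj by blast
  have I'I: "I' \<subseteq> I" using I' by (auto simp: I0_def)
  have "card I' = card J"
    using I' I'I fin by (intro inverse_on_card_eq[OF _ _ I'(2)]) (auto intro: finite_subset)
  then have kX: "real k * X j i \<in> \<int>" if "j \<in> J" "i \<in> I'" for j i
    using reg I'(2) I'I J that unfolding k_regular_def by blast
  \<comment> \<open>In a tight row the columns outside \<open>J\<close> contribute 0 or
    \<open>B i j * M\<close>, so what remains for the columns in \<open>J\<close> is still divisible
    by \<open>k\<close>.\<close>
  have rhs: "\<exists>q::int. (\<Sum>j\<in>J. B i j * y $ j) = of_int q * real k" if "i \<in> I'" for i
  proof -
    have tight: "(\<Sum>j\<in>T. B i j * y $ j) = b i" and "i \<in> I"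
      using that I' by (auto simp: I0_def)
    have "\<exists>q::int. B i j * y $ j = of_int q * real k" if "j \<in> T - J" for j
    proof -
      have "y $ j = 0 \<or> y $ j = M"
        using that y by (force simp: J_def boxed_fibre_def)
      then show ?thesis
        using M(2)[OF \<open>i \<in> I\<close>, of j] that by (auto intro: exI[of _ 0])
    qed
    then obtain q where q: "\<And>j. j \<in> T - J \<Longrightarrow> B i j * y $ j = of_int (q j) * real k"
      by metis
    obtain p :: int where p: "b i = of_int p * real k" using b \<open>i \<in> I\<close> by blast
    have "b i = (\<Sum>j\<in>T - J. B i j * y $ j) + (\<Sum>j\<in>J. B i j * y $ j)"
      using tight sum.subset_diff[OF J, of "\<lambda>j. B i j * y $ j"] by simp
    also have "(\<Sum>j\<in>T - J. B i j * y $ j) = of_int (\<Sum>j\<in>T - J. q j) * real k"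
      by (simp add: q sum_distrib_right)
    finally have "(\<Sum>j\<in>J. B i j * y $ j) = of_int (p - (\<Sum>j\<in>T - J. q j)) * real k"
      using p by (simp add: left_diff_distrib)
    then show ?thesis by blast
  qed
  show ?thesis
  proof (cases "j \<in> J")
    case True
    have left: "(\<Sum>i\<in>I'. X j i * B i j') = (if j = j' then 1 else 0)" if "j' \<in> J" for j'
      using I'(2) True that unfolding inverse_on_def by blast
    \<comment> \<open>Solve the subsystem with the left inverse: \<open>y = X (R y)\<close> on
      \<open>J\<close>. The factor \<open>k\<close> of each entry of \<open>R y\<close> is then
      handed to \<open>X\<close>, where regularity applies.\<close>
    have "y $ j = (\<Sum>j'\<in>J. (if j = j' then 1 else 0) * y $ j')"
      using True by (simp add: if_distribR if_distrib sum.delta cong: if_cong)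
    also have "\<dots> = (\<Sum>j'\<in>J. (\<Sum>i\<in>I'. X j i * B i j') * y $ j')"
      by (rule sum.cong) (simp_all only: left)
    also have "\<dots> = (\<Sum>i\<in>I'. X j i * (\<Sum>j'\<in>J. B i j' * y $ j'))"
      unfolding sum_distrib_right sum_distrib_left by (subst sum.swap) (simp add: mult.assoc)
    also have "\<dots> \<in> \<int>"
    proof (rule Ints_sum)
      fix i assume i: "i \<in> I'"
      then obtain q :: int where "(\<Sum>j'\<in>J. B i j' * y $ j') = of_int q * real k"
        using rhs by blast
      then have "X j i * (\<Sum>j'\<in>J. B i j' * y $ j') = of_int q * (real k * X j i)" by simp
      also have "\<dots> \<in> \<int>" using kX[OF True i] by (blast intro: Ints_mult Ints_of_int)
      finally show "X j i * (\<Sum>j'\<in>J. B i j' * y $ j') \<in> \<int>" .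
    qed
    finally show ?thesis .
  next
    case False
    then have "y $ j = 0 \<or> y $ j = M"
      using j y by (force simp: J_def boxed_fibre_def)
    then show ?thesis using M(1) by auto
  qed
qed

section \<open>From the fibres to the mixed-integer hulls\<close>

lemma k_regular_fibre_in_convex_hull:
  fixes w :: "real ^ 'n::finite"
  assumes fin: "finite I" and reg: "k_regular k I T B" and k: "k \<ge> 1"
    and b: "\<And>i. i \<in> I \<Longrightarrow> \<exists>q::int. b i = of_int q * real k"
    and w: "\<And>j. j \<in> T \<Longrightarrow> 0 \<le> w $ j" "\<And>i. i \<in> I \<Longrightarrow> (\<Sum>j\<in>T. B i j * w $ j) \<le> b i"
  shows "w \<in> convex hull {v. (\<forall>j. j \<notin> T \<longrightarrow> v $ j = w $ j) \<and> (\<forall>j\<in>T. 0 \<le> v $ j \<and> v $ j \<in> \<int>) \<and>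
    (\<forall>i\<in>I. (\<Sum>j\<in>T. B i j * v $ j) \<le> b i)}" (is "w \<in> convex hull ?V")
proof -
  have "finite (case_prod B ` (I \<times> T))" using fin by simp
  moreover have "case_prod B ` (I \<times> T) \<subseteq> \<rat>"
    using k_regular_entry_Rats[OF reg k] by auto
  ultimately obtain d :: nat where d: "d \<ge> 1"
    "\<And>q. q \<in> case_prod B ` (I \<times> T) \<Longrightarrow> real d * q \<in> \<int>"
    by (rule finite_Rats_common_denominator) blast
  \<comment> \<open>As \<open>w\<close> is nonnegative on \<open>T\<close>, its coordinate sum there
    bounds each coordinate. In \<open>M = k * d * m\<close>, the factor \<open>d\<close> clears the
    denominators of \<open>B\<close> and \<open>k\<close> gives the divisibility; both are at least
    1, so \<open>M\<close> still dominates \<open>m\<close>.\<close>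
  obtain m :: nat where m: "(\<Sum>j\<in>T. w $ j) \<le> real m"
    using real_arch_simple by blast
  define M where "M = real (k * d * m)"
  have "m \<le> k * d * m" using k d(1) by simp
  then have mM: "real m \<le> M" unfolding M_def of_nat_le_iff .
  have "w $ j \<le> M" if "j \<in> T" for j
    using member_le_sum[OF that, of "\<lambda>j. w $ j"] w(1) m mM by fastforce
  then have wF: "w \<in> boxed_fibre I T B b M w"
    using w by (simp add: boxed_fibre_def)
  have MB: "\<exists>q::int. B i j * M = of_int q * real k" if "i \<in> I" "j \<in> T" for i j
  proof -
    have "real d * B i j \<in> \<int>" using d(2) that by force
    then obtain z :: int where z: "real d * B i j = of_int z" by (auto elim: Ints_cases)
    have "B i j * M = (real d * B i j) * real m * real k" by (simp add: M_def)
    also have "\<dots> = of_int (z * int m) * real k" by (simp add: z)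
    finally show ?thesis by blast
  qed
  \<comment> \<open>The upper bound \<open>M\<close> can now be dropped: it served only to make the
    fibre compact, so that its extreme points generate \<open>w\<close>.\<close>
  have "{x. x extreme_point_of boxed_fibre I T B b M w} \<subseteq> ?V"
  proof
    fix x assume "x \<in> {x. x extreme_point_of boxed_fibre I T B b M w}"
    then have x: "x extreme_point_of boxed_fibre I T B b M w" by simp
    then have "x \<in> boxed_fibre I T B b M w" by (simp add: extreme_point_of_def)
    moreover have "x $ j \<in> \<int>" if "j \<in> T" for j
      using extreme_point_boxed_fibre_integral[OF fin reg x _ MB b that] by (simp add: M_def)
    ultimately show "x \<in> ?V" by (auto simp: boxed_fibre_def)
  qed
  moreover have "w \<in> convex hull {x. x extreme_point_of boxed_fibre I T B b M w}"
    using Krein_Milman_Minkowski[OF compact_boxed_fibre convex_boxed_fibre] wF by blast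
  ultimately show ?thesis using hull_mono by blast
qed

theorem theorem14:
  fixes S T U N :: "'n::finite set"
    and I :: "'m set" and H :: "'q set"
    and A B :: "'m \<Rightarrow> 'n \<Rightarrow> real" and c :: "'m \<Rightarrow> real"
    and D E :: "'q \<Rightarrow> 'n \<Rightarrow> real" and f :: "'q \<Rightarrow> real"
    and P :: "(real ^ 'n) set" and k :: nat
  assumes "S \<inter> T = {}" and "S \<inter> U = {}" and "T \<inter> U = {}" and "N = S \<union> T \<union> U"
    and "finite I" and "finite H"
    and "P = {w \<in> coord_space N.
               (\<forall>i \<in> I. (\<Sum>j \<in> S. A i j * w $ j) + (\<Sum>j \<in> T. B i j * w $ j) \<le> c i) \<and>
               (\<forall>j \<in> T. w $ j \<ge> 0) \<and>
               (\<forall>i \<in> H. (\<Sum>j \<in> S. D i j * w $ j) + (\<Sum>j \<in> U. E i j * w $ j) \<le> f i)}"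
    and "rational_polyhedron P"
    and "k \<ge> 1"
    and "k_regular k I T B"
    and "\<forall>xbar \<in> coord_proj S P \<inter> mixed_int S S. \<forall>i \<in> I.
           \<exists>q :: int. c i - (\<Sum>j \<in> S. A i j * xbar $ j) = of_int q * real k"
  shows "totally_implied_integer N P S T"
  unfolding totally_implied_integer_def implied_integer_def
proof (intro allI impI subset_antisym)
  fix S'' assume S'': "S \<subseteq> S'' \<and> S'' \<subseteq> N"
  show "convex hull (P \<inter> mixed_int N (S'' \<union> T)) \<subseteq> convex hull (P \<inter> mixed_int N S'')"
    by (intro hull_mono) (auto simp: mixed_int_def)
  show "convex hull (P \<inter> mixed_int N S'') \<subseteq> convex hull (P \<inter> mixed_int N (S'' \<union> T))"
  \<comment> \<open>The right-hand hull is convex, so it suffices to treat single points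
    \<open>w\<close>, each within its own fibre.\<close>
  proof (rule hull_minimal)
    show "P \<inter> mixed_int N S'' \<subseteq> convex hull (P \<inter> mixed_int N (S'' \<union> T))"
    proof
      fix w assume w: "w \<in> P \<inter> mixed_int N S''"
      define xbar where "xbar = (\<chi> i. if i \<in> S then w $ i else 0)"
      define b where "b i = c i - (\<Sum>j\<in>S. A i j * w $ j)" for i
      \<comment> \<open>Integrality of \<open>xbar\<close> comes from
        \<open>S \<subseteq> S''\<close>; this is where the congruence hypothesis becomes available
        for \<open>w\<close>.\<close>
      have "xbar \<in> coord_proj S P \<inter> mixed_int S S"
        using w S'' by (auto simp: xbar_def coord_proj_def mixed_int_def coord_space_def)
      moreover have "(\<Sum>j\<in>S. A i j * xbar $ j) = (\<Sum>j\<in>S. A i j * w $ j)" for i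
        by (simp add: xbar_def)
      ultimately have b: "\<exists>q::int. b i = of_int q * real k" if "i \<in> I" for i
        using assms(11) that unfolding b_def by metis
      let ?V = "{v. (\<forall>j. j \<notin> T \<longrightarrow> v $ j = w $ j) \<and> (\<forall>j\<in>T. 0 \<le> v $ j \<and> v $ j \<in> \<int>) \<and>
        (\<forall>i\<in>I. (\<Sum>j\<in>T. B i j * v $ j) \<le> b i)}"
      have "0 \<le> w $ j" if "j \<in> T" for j
        using w that assms(7) by auto
      moreover have "(\<Sum>j\<in>T. B i j * w $ j) \<le> b i" if "i \<in> I" for i
        using w that assms(7) by (force simp: b_def)
      ultimately have "w \<in> convex hull ?V"
        by (intro k_regular_fibre_in_convex_hull[OF assms(5,10,9) b])
      \<comment> \<open>Since \<open>S\<close> and \<open>U\<close> are disjoint from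
        \<open>T\<close>, moving within \<open>?V\<close> leaves the constraints with
        \<open>D\<close> and \<open>E\<close> and the right-hand side \<open>b\<close> unchanged.
        \<open>S''\<close> may meet \<open>T\<close>: there integrality comes from
        \<open>?V\<close>, elsewhere it is inherited from \<open>w\<close>.\<close>
      moreover have "?V \<subseteq> P \<inter> mixed_int N (S'' \<union> T)"
      proof
        fix v assume v: "v \<in> ?V"
        have sums: "(\<Sum>j\<in>S. F j * v $ j) = (\<Sum>j\<in>S. F j * w $ j)"
          "(\<Sum>j\<in>U. F j * v $ j) = (\<Sum>j\<in>U. F j * w $ j)" for F
          using v assms(1,3) by (auto intro!: sum.cong)
        have vN: "v \<in> coord_space N"
          using v w assms(4) by (auto simp: mixed_int_def coord_space_def)
        moreover have "v $ j \<in> \<int>" if "j \<in> S'' \<union> T" for j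
          using v w that by (cases "j \<in> T") (auto simp: mixed_int_def)
        moreover have "v \<in> P"
          using v w vN unfolding assms(7) by (auto simp: sums b_def algebra_simps)
        ultimately show "v \<in> P \<inter> mixed_int N (S'' \<union> T)"
          by (simp add: mixed_int_def)
      qed
      ultimately show "w \<in> convex hull (P \<inter> mixed_int N (S'' \<union> T))"
        using hull_mono by blast
    qed
  qed (rule convex_convex_hull)
qed

end
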